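(* Let $F$ be any field. Then the following two conditions are equivalent: (2) each nonlinear polynomial of odd degree in $F[x]$ is reducible in $F[x]$; (2)$'$ each polynomial of odd prime degree over $F$ has a root in $F$.
   Context: $F$ is an arbitrary field (no assumption on its characteristic). A nonlinear polynomial of odd degree is a polynomial of odd degree greater than $1$. An odd prime is a prime integer different from $2$. *)

theory Defs
  imports "HOL-Computational_Algebra.Computational_Algebra"
begin

end

(*
  The interesting direction assumes that every polynomial of odd prime degree has a root.

  The degrees of the rootless polynomials form an additive semigroup D.  If f is irreducible of odd
  degree n > 1, then n is in D, while no odd prime is, so the elements of D have a common prime
  factor q (otherwise D would contain all large numbers); q is odd, and every polynomial whose degree
  is prime to q has a root.  In particular F is infinite.

  As in Laplace's proof of the fundamental theorem of algebra, this is applied to a resolvent.  Let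
  a_i (i < n) be the roots of f in the algebraic closure, write n = q^k * q * m with m prime to q,
  and let pi range over the families of q pairwise disjoint sets of q^k indices.  Their number is
  prime to q.  For s, t in F put F(s,t,pi) = prod_{B in pi} (s - prod_{i in B} (t - a_i)).  The
  product of Y - F(s,t,pi) over all pi is symmetric in the a_i, hence lies in F[Y], hence has a root,
  so that F(s,t,pi) is in F for some pi.  For fixed t one pi works for infinitely many s, which puts
  prod_{B in pi} (X - prod_{i in B} (t - a_i)) into F[X].  This has degree q, so it has a root, that
  is, prod_{i in B} (t - a_i) is in F for some B.  One B works for infinitely many t, which puts
  prod_{i in B} (X - a_i) into F[X]: a factor of f of degree q^k, with 0 < q^k < n.  Separability
  plays no role.
*)
theory Submission
  imports "HOL-Algebra.Algebraic_Closure_Type" "HOL-Algebra.Exponent"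
    "HOL-Combinatorics.Permutations" Defs
begin

section \<open>Symmetric polynomial functions\<close>

text \<open>Exponent vectors are total functions; the zeros from \<open>n\<close> on make equality
  of functions the same as equality of the first \<open>n\<close> entries.\<close>

definition exponents :: "nat \<Rightarrow> (nat \<Rightarrow> nat) set" where
  "exponents n = {m. \<forall>i\<ge>n. m i = 0}"

definition monomial_val :: "nat \<Rightarrow> (nat \<Rightarrow> 'a::comm_ring_1) \<Rightarrow> (nat \<Rightarrow> nat) \<Rightarrow> 'a" where
  "monomial_val n x m = (\<Prod>i<n. x i ^ m i)"

lemma monomial_val_add: "monomial_val n x (\<lambda>i. a i + b i) = monomial_val n x a * monomial_val n x b"
  by (simp add: monomial_val_def power_add prod.distrib)

lemma exponents_eqI:
  assumes "a \<in> exponents n" "b \<in> exponents n" "\<And>i. i < n \<Longrightarrow> a i = b i"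
  shows "a = b"
proof
  fix i show "a i = b i"
    using assms by (cases "i < n") (auto simp: exponents_def)
qed

text \<open>Induction on the number of variables: with the others fixed, the sum is a polynomial in
  the last variable that vanishes on an infinite field. The separation hypothesis speaks of the
  first \<open>n\<close> entries only, because after a variable has been removed the vectors still
  carry their entry for it.\<close>

lemma monomial_val_sum_eq_0_imp:
  fixes c :: "(nat \<Rightarrow> nat) \<Rightarrow> 'a::field"
  assumes inf: "infinite (UNIV :: 'a set)" and "finite M"
    and "\<And>a b. a \<in> M \<Longrightarrow> b \<in> M \<Longrightarrow> (\<And>i. i < n \<Longrightarrow> a i = b i) \<Longrightarrow> a = b"
    and "\<And>x. (\<Sum>m\<in>M. c m * monomial_val n x m) = 0" and "a \<in> M"
  shows "c a = 0"
  using assms(2-)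
proof (induction n arbitrary: M)
  case 0
  then have "M = {a}" by blast
  then show ?case using 0(3)[of undefined] by (simp add: monomial_val_def)
next
  case (Suc n)
  define j where "j = a n"
  define N where "N = {m\<in>M. m n = j}"
  have "(\<Sum>m\<in>N. c m * monomial_val n x m) = 0" for x
  proof -
    define P where "P = (\<Sum>m\<in>M. monom (c m * monomial_val n x m) (m n))"
    have "poly P y = 0" for y
    proof -
      have "monomial_val (Suc n) (x(n := y)) m = monomial_val n x m * y ^ m n" for m
        by (simp add: monomial_val_def)
      then show ?thesis
        using Suc.prems(3)[of "x(n := y)"]
        by (simp add: P_def poly_sum poly_monom mult.assoc del: fun_upd_apply)
    qed
    then have "P = 0" using inf poly_roots_finite[of P] by auto
    then have "0 = coeff P j" by simp
    also have "\<dots> = (\<Sum>m\<in>N. c m * monomial_val n x m)"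
      by (simp add: P_def coeff_sum N_def sum.inter_filter Suc.prems(1))
    finally show ?thesis by simp
  qed
  moreover have "u = v" if "u \<in> N" "v \<in> N" "\<And>i. i < n \<Longrightarrow> u i = v i" for u v
    using that Suc.prems(2)[of u v] unfolding N_def by (metis (mono_tags, lifting) less_antisym mem_Collect_eq)
  ultimately show ?case
    using Suc.IH[of N] Suc.prems(1,4) by (auto simp: N_def j_def)
qed

section \<open>Polynomial functions with coefficients in a subring\<close>

locale unital_subring =
  fixes R :: "'a::field set"
  assumes one_mem: "1 \<in> R"
    and diff_mem: "a \<in> R \<Longrightarrow> b \<in> R \<Longrightarrow> a - b \<in> R"
    and mult_mem: "a \<in> R \<Longrightarrow> b \<in> R \<Longrightarrow> a * b \<in> R"
begin

lemma zero_mem: "0 \<in> R"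
  using diff_mem[OF one_mem one_mem] by simp

lemma uminus_mem: "a \<in> R \<Longrightarrow> - a \<in> R"
  using diff_mem[OF zero_mem, of a] by simp

lemma add_mem: "a \<in> R \<Longrightarrow> b \<in> R \<Longrightarrow> a + b \<in> R"
  using diff_mem[OF _ uminus_mem, of a b] by simp

lemma sum_mem: "(\<And>i. i \<in> I \<Longrightarrow> f i \<in> R) \<Longrightarrow> sum f I \<in> R"
  by (induction I rule: infinite_finite_induct) (auto intro: zero_mem add_mem)

lemma of_nat_mem: "of_nat k \<in> R"
  by (induction k) (auto intro: zero_mem one_mem add_mem)

\<comment> \<open>Over an infinite field such a function determines its coefficients, see
  \<open>monomial_val_sum_eq_0_imp\<close>, so these functions stand for polynomials over \<open>R\<close> in \<open>n\<close> variables.\<close>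
definition polyfun :: "nat \<Rightarrow> ((nat \<Rightarrow> 'a) \<Rightarrow> 'a) \<Rightarrow> bool" where
  "polyfun n \<Phi> \<longleftrightarrow> (\<exists>M c. finite M \<and> M \<subseteq> exponents n \<and> (\<forall>m. c m \<in> R) \<and>
     (\<forall>m. m \<notin> M \<longrightarrow> c m = 0) \<and> (\<forall>x. \<Phi> x = (\<Sum>m\<in>M. c m * monomial_val n x m)))"

text \<open>Exponents may repeat along the family, as they do in sums and products; the coefficient
  of \<open>m\<close> collects the fibre of \<open>e\<close> over \<open>m\<close>.\<close>

lemma polyfunI:
  assumes "finite I" "\<And>i. i \<in> I \<Longrightarrow> e i \<in> exponents n" "\<And>i. i \<in> I \<Longrightarrow> d i \<in> R"
    and "\<And>x. \<Phi> x = (\<Sum>i\<in>I. d i * monomial_val n x (e i))"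
  shows "polyfun n \<Phi>"
  unfolding polyfun_def
proof (intro exI[of _ "e ` I"] exI[of _ "\<lambda>m. \<Sum>i\<in>{i\<in>I. e i = m}. d i"] conjI allI impI)
  show "(\<Sum>i\<in>{i\<in>I. e i = m}. d i) \<in> R" for m
    using assms(3) by (intro sum_mem) auto
  show "(\<Sum>i\<in>{i\<in>I. e i = m}. d i) = 0" if "m \<notin> e ` I" for m
    using that by (intro sum.neutral) auto
  show "\<Phi> x = (\<Sum>m\<in>e ` I. (\<Sum>i\<in>{i\<in>I. e i = m}. d i) * monomial_val n x m)" for x
    unfolding assms(4) by (subst sum.image_gen[OF assms(1), of _ e]) (auto simp: sum_distrib_right intro!: sum.cong)
qed (use assms in auto)

lemma polyfun_const: "a \<in> R \<Longrightarrow> polyfun n (\<lambda>_. a)"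
  by (rule polyfunI[of "{()}" "\<lambda>_ _. 0" _ "\<lambda>_. a"]) (auto simp: exponents_def monomial_val_def)

lemma polyfun_var:
  assumes "i < n"
  shows "polyfun n (\<lambda>x. x i)"
proof (rule polyfunI[of "{()}" "\<lambda>_ j. if j = i then 1 else 0" _ "\<lambda>_. 1"])
  show "x i = (\<Sum>_\<in>{()}. 1 * monomial_val n x (\<lambda>j. if j = i then 1 else 0))"
    for x :: "nat \<Rightarrow> 'a"
    using assms by (simp add: monomial_val_def if_distrib[of "\<lambda>k. _ ^ k"] cong: if_cong)
qed (use assms in \<open>auto simp: exponents_def one_mem\<close>)

lemma polyfun_add:
  assumes "polyfun n f" "polyfun n g"
  shows "polyfun n (\<lambda>x. f x + g x)"
proof -
  obtain M c where M: "finite M" "M \<subseteq> exponents n" "\<And>m. c m \<in> R"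
    "\<And>x. f x = (\<Sum>m\<in>M. c m * monomial_val n x m)"
    using assms(1) unfolding polyfun_def by blast
  obtain N d where N: "finite N" "N \<subseteq> exponents n" "\<And>m. d m \<in> R"
    "\<And>x. g x = (\<Sum>m\<in>N. d m * monomial_val n x m)"
    using assms(2) unfolding polyfun_def by blast
  show ?thesis
    by (rule polyfunI[of "M <+> N" "case_sum id id" _ "case_sum c d"])
       (use M N in \<open>auto simp: sum.Plus split: sum.splits\<close>)
qed

lemma polyfun_mult:
  assumes "polyfun n f" "polyfun n g"
  shows "polyfun n (\<lambda>x. f x * g x)"
proof -
  obtain M c where M: "finite M" "M \<subseteq> exponents n" "\<And>m. c m \<in> R"
    "\<And>x. f x = (\<Sum>m\<in>M. c m * monomial_val n x m)"
    using assms(1) unfolding polyfun_def by blast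
  obtain N d where N: "finite N" "N \<subseteq> exponents n" "\<And>m. d m \<in> R"
    "\<And>x. g x = (\<Sum>m\<in>N. d m * monomial_val n x m)"
    using assms(2) unfolding polyfun_def by blast
  show ?thesis
  proof (rule polyfunI[of "M \<times> N" "\<lambda>p i. fst p i + snd p i" _ "\<lambda>p. c (fst p) * d (snd p)"])
    show "f x * g x = (\<Sum>p\<in>M \<times> N. c (fst p) * d (snd p) * monomial_val n x (\<lambda>i. fst p i + snd p i))" for x
      unfolding M N sum_product sum.cartesian_product monomial_val_add
      by (auto intro!: sum.cong simp: mult_ac)
  qed (use M N in \<open>auto simp: exponents_def mult_mem\<close>)
qed

lemma polyfun_diff:
  assumes "polyfun n f" "polyfun n g"
  shows "polyfun n (\<lambda>x. f x - g x)"
  using polyfun_add[OF assms(1) polyfun_mult[OF polyfun_const[OF uminus_mem[OF one_mem]] assms(2)]]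
  by simp

lemma polyfun_prod:
  "(\<And>i. i \<in> I \<Longrightarrow> polyfun n (f i)) \<Longrightarrow> polyfun n (\<lambda>x. \<Prod>i\<in>I. f i x)"
  by (induction I rule: infinite_finite_induct) (auto intro: polyfun_const[OF one_mem] polyfun_mult)

text \<open>Multiplying by a monic linear factor shifts the coefficients and subtracts a multiple of
  them. This covers the coefficients of the resolvent.\<close>

lemma polyfun_coeff_prod_linear:
  assumes "\<And>i. i \<in> I \<Longrightarrow> polyfun n (f i)"
  shows "polyfun n (\<lambda>x. coeff (\<Prod>i\<in>I. [:- f i x, 1:]) j)"
  using assms
proof (induction I arbitrary: j rule: infinite_finite_induct)
  case (insert i I)
  define g where "g x = (\<Prod>i\<in>I. [:- f i x, 1:])" for x
  have IH: "polyfun n (\<lambda>x. coeff (g x) j)" for j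
    using insert unfolding g_def by simp
  have "coeff (\<Prod>i\<in>insert i I. [:- f i x, 1:]) j =
     (case j of 0 \<Rightarrow> 0 | Suc k \<Rightarrow> coeff (g x) k) - f i x * coeff (g x) j" for x
    using insert by (simp add: g_def coeff_pCons split: nat.split)
  moreover have "polyfun n (\<lambda>x. case j of 0 \<Rightarrow> 0 | Suc k \<Rightarrow> coeff (g x) k)"
    using IH by (cases j) (auto intro: polyfun_const[OF zero_mem])
  ultimately show ?case
    using polyfun_diff[OF _ polyfun_mult[OF insert.prems[of i] IH[of j]]] by simp
qed (auto intro: polyfun_const zero_mem one_mem)

end

section \<open>Orbits of exponent vectors under permutations of the variables\<close>

definition shape :: "nat \<Rightarrow> (nat \<Rightarrow> nat) \<Rightarrow> nat multiset" where
  "shape n m = image_mset m (mset_set {..<n})"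

text \<open>Equal multisets of values differ by a permutation of the indices, and from
  \<open>n\<close> on both vectors vanish. So \<open>shape\<close> is a complete invariant of the
  orbits.\<close>

lemma shape_eq_imp_permutes:
  assumes "shape n a = shape n b" "a \<in> exponents n" "b \<in> exponents n"
  obtains \<sigma> where "\<sigma> permutes {..<n}" "a = b \<circ> \<sigma>"
proof -
  obtain p where p: "p permutes {..<n}" "\<forall>i\<in>{..<n}. a i = b (p i)"
    using image_mset_eq_implies_permutes[of "{..<n}" a b] assms(1) unfolding shape_def by auto
  have "a = b \<circ> p"
  proof
    fix i show "a i = (b \<circ> p) i"
      using p assms(2,3) permutes_not_in[OF p(1), of i]
      by (cases "i < n") (auto simp: exponents_def)
  qed
  with p(1) show ?thesis by (rule that)
qed

lemma shape_permute: "\<sigma> permutes {..<n} \<Longrightarrow> shape n (m \<circ> \<sigma>) = shape n m"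
  unfolding shape_def
  by (metis finite_lessThan image_mset.compositionality image_mset_mset_set permutes_image permutes_inj_on)

lemma exponents_permute: "\<sigma> permutes {..<n} \<Longrightarrow> m \<in> exponents n \<Longrightarrow> m \<circ> \<sigma> \<in> exponents n"
  by (auto simp: exponents_def permutes_not_in)

lemma monomial_val_permute:
  assumes "\<sigma> permutes {..<n}"
  shows "monomial_val n (x \<circ> \<sigma>) (m \<circ> \<sigma>) = monomial_val n x m"
  unfolding monomial_val_def o_def
  using prod.permute[OF assms, of "\<lambda>i. x i ^ m i"] by (simp add: o_def)

lemma finite_exponents_shape: "finite {m\<in>exponents n. shape n m = L}"
proof (rule finite_subset)
  show "{m\<in>exponents n. shape n m = L} \<subseteq> {m. \<forall>i. (i \<in> {..<n} \<longrightarrow> m i \<in> set_mset L) \<and> (i \<notin> {..<n} \<longrightarrow> m i = 0)}"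
    by (auto simp: exponents_def shape_def)
  show "finite \<dots>" by (rule finite_set_of_finite_funs) auto
qed

text \<open>The monomial symmetric function attached to \<open>L\<close>, a partition padded with
  zeros to \<open>n\<close> parts; each distinct monomial occurs once.\<close>

definition monomial_sym :: "nat \<Rightarrow> (nat \<Rightarrow> 'a::comm_ring_1) \<Rightarrow> nat multiset \<Rightarrow> 'a" where
  "monomial_sym n x L = (\<Sum>m\<in>{m\<in>exponents n. shape n m = L}. monomial_val n x m)"

text \<open>Group the terms by shape. Vectors of a given shape that are missing from
  \<open>M\<close> have coefficient 0, so each group can be completed to a full orbit.\<close>

lemma symmetric_sum_eq_monomial_sym:
  assumes M: "finite M" "M \<subseteq> exponents n"
    and c: "\<And>m. m \<in> exponents n \<Longrightarrow> c m = C (shape n m)"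
    and c0: "\<And>m. m \<in> exponents n \<Longrightarrow> m \<notin> M \<Longrightarrow> c m = 0"
  shows "(\<Sum>m\<in>M. c m * monomial_val n x m) = (\<Sum>L\<in>shape n ` M. C L * monomial_sym n x L)"
proof -
  have "(\<Sum>m\<in>{m\<in>M. shape n m = L}. c m * monomial_val n x m) = C L * monomial_sym n x L" for L
  proof -
    have "(\<Sum>m\<in>{m\<in>M. shape n m = L}. c m * monomial_val n x m) =
      (\<Sum>m\<in>{m\<in>exponents n. shape n m = L}. c m * monomial_val n x m)"
      using M c0 by (intro sum.mono_neutral_left finite_exponents_shape) fastforce+
    also have "\<dots> = C L * monomial_sym n x L"
      unfolding monomial_sym_def sum_distrib_left using c by (intro sum.cong) auto
    finally show ?thesis .
  qed
  then show ?thesis by (subst sum.image_gen[OF M(1), of _ "shape n"]) simp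
qed

text \<open>Truncated predecessor confuses only 0 with 1, and the number of zeros tells these
  apart.\<close>

lemma multiset_eq_of_pred_image:
  assumes "image_mset (\<lambda>v. v - 1) A = image_mset (\<lambda>v. v - 1) B" "count A 0 = count B (0::nat)"
  shows "A = B"
proof -
  have eq1: "image_mset (\<lambda>v. v - 1) Y = replicate_mset (count Y 0) 0 + image_mset (\<lambda>v. v - 1) (filter_mset (\<lambda>v. v \<noteq> 0) Y)"
    for Y :: "nat multiset"
    by (induction Y) auto
  have eq2: "Y = replicate_mset (count Y 0) 0 + image_mset Suc (image_mset (\<lambda>v. v - 1) (filter_mset (\<lambda>v. v \<noteq> 0) Y))"
    for Y :: "nat multiset"
    by (induction Y) auto
  have "image_mset (\<lambda>v. v - 1) (filter_mset (\<lambda>v. v \<noteq> 0) A) = image_mset (\<lambda>v. v - 1) (filter_mset (\<lambda>v. v \<noteq> 0) B)"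
    using eq1[of A] eq1[of B] assms by simp
  then show ?thesis using eq2[of A] eq2[of B] assms(2) by simp
qed

lemma count_shape_0: "count (shape n m) 0 = n - card {i. i < n \<and> m i \<noteq> 0}"
proof -
  have "count (shape n m) 0 = card {i\<in>{..<n}. m i = 0}"
    by (simp add: shape_def count_image_mset_eq_card_vimage)
  also have "{i\<in>{..<n}. m i = 0} = {..<n} - {i. i < n \<and> m i \<noteq> 0}" by auto
  also have "card \<dots> = n - card {i. i < n \<and> m i \<noteq> 0}"
    by (subst card_Diff_subset) auto
  finally show ?thesis .
qed

lemma sum_mset_shape: "sum_mset (shape n m) = (\<Sum>i<n. m i)"
  by (simp add: shape_def sum_unfold_sum_mset)

lemma shape_pred: "shape n (\<lambda>i. m i - 1) = image_mset (\<lambda>v. v - 1) (shape n m)"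
  by (simp add: shape_def multiset.map_comp o_def)

lemma monomial_val_indicator: "S \<subseteq> {..<n} \<Longrightarrow> monomial_val n x (\<lambda>i. of_bool (i \<in> S)) = (\<Prod>i\<in>S. x i)"
  unfolding monomial_val_def by (rule prod.mono_neutral_cong_right) auto

section \<open>The fundamental theorem on symmetric polynomials\<close>

context unital_subring
begin

text \<open>Lexicographic induction, first on the degree \<open>sum_mset L\<close>, then on the
  number of zeros in \<open>L\<close>.\<close>

lemma monomial_sym_mem:
  assumes e: "\<And>k. (\<Sum>S\<in>{S. S \<subseteq> {..<n} \<and> card S = k}. \<Prod>i\<in>S. x i) \<in> R"
  shows "monomial_sym n x L \<in> R"
  using wf_measures[of "[sum_mset, \<lambda>L. count L 0]"]
proof (induction L rule: wf_induct_rule)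
  case (less L)
  define supp where "supp m = {i. i < n \<and> m i \<noteq> (0::nat)}" for m
  have supp_le: "card (supp m) \<le> n" for m
    using card_mono[of "{..<n}" "supp m"] by (auto simp: supp_def)
  show ?case
  proof (cases "{m\<in>exponents n. shape n m = L} = {}")
    case True
    then show ?thesis unfolding monomial_sym_def True by (simp add: zero_mem)
  next
    case False
    then obtain m0 where m0: "m0 \<in> exponents n" "shape n m0 = L" by auto
    define k where "k = card (supp m0)"
    define L0 where "L0 = image_mset (\<lambda>v. v - 1) L"
    define E where "E = {S. S \<subseteq> {..<n} \<and> card S = k}"
    define I where "I = E \<times> {m\<in>exponents n. shape n m = L0}"
    \<comment> \<open>Let \<open>k\<close> be the number of nonzero parts of \<open>L\<close> and let \<open>L0\<close> be \<open>L\<close> with these lowered by one.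
        Then \<open>e\<^sub>k\<close> times the symmetric monomial of \<open>L0\<close> is that of \<open>L\<close>, with coefficient 1, plus
        integer multiples of symmetric monomials of the same degree with more than \<open>k\<close> nonzero parts.\<close>
    define h where "h p i = of_bool (i \<in> fst p) + snd p i" for p :: "nat set \<times> (nat \<Rightarrow> nat)" and i
    have finI: "finite I" unfolding I_def E_def by (simp add: finite_exponents_shape)
    have h_exp: "h p \<in> exponents n" if "p \<in> I" for p
      using that unfolding I_def E_def h_def exponents_def by force
    have sub: "fst p \<subseteq> supp (h p)" if "p \<in> I" for p
      using that by (auto simp: supp_def h_def I_def E_def)
    \<comment> \<open>Every \<open>h p\<close> has at least \<open>k\<close> nonzero entries; if it
      has exactly \<open>k\<close>, then \<open>p\<close> can be recovered from it. This isolates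
      the leading term.\<close>
    have full: "fst p = supp (h p)" "snd p = (\<lambda>i. h p i - 1)"
      if "p \<in> I" "card (supp (h p)) = k" for p
    proof -
      show eq: "fst p = supp (h p)"
        using sub[OF that(1)] that by (intro card_subset_eq) (auto simp: supp_def I_def E_def)
      have "snd p i = h p i - 1" for i
      proof (cases "i \<in> fst p")
        case True
        then show ?thesis by (simp add: h_def)
      next
        case False
        then have "h p i = 0"
          using h_exp[OF that(1)] unfolding eq supp_def exponents_def by (cases "i < n") auto
        then show ?thesis using False by (simp add: h_def)
      qed
      then show "snd p = (\<lambda>i. h p i - 1)" ..
    qed
    have p0: "(supp m0, \<lambda>i. m0 i - 1) \<in> I" "h (supp m0, \<lambda>i. m0 i - 1) = m0"
    proof -
      have "shape n (\<lambda>i. m0 i - 1) = L0" by (simp only: shape_pred L0_def m0(2))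
      then show "(supp m0, \<lambda>i. m0 i - 1) \<in> I"
        using m0 by (auto simp: I_def E_def k_def exponents_def supp_def)
      show "h (supp m0, \<lambda>i. m0 i - 1) = m0"
        using m0(1) by (auto simp: h_def fun_eq_iff supp_def exponents_def)
    qed
    have sum_h: "sum_mset (shape n (h p)) = k + sum_mset L0" if "p \<in> I" for p
    proof -
      have "(\<Sum>i<n. of_bool (i \<in> fst p)) = card ({..<n} \<inter> fst p)"
        by (subst sum_of_bool_eq) (auto intro: arg_cong[where f = card])
      also have "\<dots> = k" using that by (auto simp: I_def E_def Int_absorb1)
      finally show ?thesis
        using that unfolding sum_mset_shape h_def sum.distrib by (auto simp: I_def sum_mset_shape)
    qed
    have sumL: "sum_mset L = k + sum_mset L0"
      using sum_h[OF p0(1)] p0(2) m0 by simp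
    show ?thesis
    proof (cases "k = 0")
      \<comment> \<open>Here the degree does not drop from \<open>L\<close> to \<open>L0\<close>, so
        the induction hypothesis is out of reach; but the only monomial is 1.\<close>
      case True
      have "m0 = (\<lambda>_. 0)"
      proof
        fix i
        have "supp m0 = {}" using True by (simp add: k_def supp_def)
        then show "m0 i = 0"
          using m0(1) by (cases "i < n") (auto simp: supp_def exponents_def)
      qed
      have "m = (\<lambda>_. 0)" if m: "m \<in> exponents n" "shape n m = L" for m
      proof -
        obtain \<sigma> where "m = m0 \<circ> \<sigma>"
          using shape_eq_imp_permutes[of n m m0] m m0 by metis
        then show ?thesis using \<open>m0 = (\<lambda>_. 0)\<close> by auto
      qed
      then have "{m\<in>exponents n. shape n m = L} = {\<lambda>_. 0}" using False by blast
      then show ?thesis by (simp add: monomial_sym_def monomial_val_def one_mem)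
    next
      case k: False
      define N where "N m = card {p\<in>I. h p = m}" for m
      have N_le: "N b \<le> N a" if ab: "shape n a = shape n b" "a \<in> exponents n" "b \<in> exponents n" for a b
      proof -
        obtain \<sigma> where s: "\<sigma> permutes {..<n}" "a = b \<circ> \<sigma>"
          using shape_eq_imp_permutes[OF ab] by metis
        \<comment> \<open>Permuting both components of a pair carries the representations of
          \<open>b\<close> injectively to those of \<open>a\<close>. By symmetry \<open>N\<close> is
          constant on shapes, so it factors through some \<open>C\<close>.\<close>
        define \<phi> where "\<phi> p = (\<sigma> -` fst p, snd p \<circ> \<sigma>)" for p :: "nat set \<times> (nat \<Rightarrow> nat)"
        have "inj_on \<phi> {p\<in>I. h p = b}"
        proof (rule inj_onI)
          fix p p' assume "\<phi> p = \<phi> p'"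
          then have "\<sigma> -` fst p = \<sigma> -` fst p'" "snd p \<circ> \<sigma> = snd p' \<circ> \<sigma>" by (auto simp: \<phi>_def)
          moreover from this have "fst p = fst p'"
            using surj_image_vimage_eq[OF permutes_surj[OF s(1)]] by metis
          moreover have "snd p i = snd p' i" for i
          proof -
            obtain j where "i = \<sigma> j" using permutes_surj[OF s(1)] by (metis surjD)
            then show ?thesis using \<open>snd p \<circ> \<sigma> = snd p' \<circ> \<sigma>\<close> by (metis comp_apply)
          qed
          ultimately show "p = p'" by (auto simp: prod_eq_iff)
        qed
        moreover have "\<phi> ` {p\<in>I. h p = b} \<subseteq> {p\<in>I. h p = a}"
        proof
          fix y assume "y \<in> \<phi> ` {p\<in>I. h p = b}"
          then obtain p where p: "p \<in> I" "h p = b" "y = \<phi> p" by auto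
          have "h y = a" unfolding p(3) s(2) p(2)[symmetric] by (auto simp: h_def \<phi>_def)
          moreover have "\<sigma> -` fst p \<subseteq> {..<n}"
            using p(1) permutes_in_image[OF s(1)] by (auto simp: I_def E_def subset_iff)
          moreover have "card (\<sigma> -` fst p) = card (fst p)"
            using permutes_inj[OF s(1)] permutes_surj[OF s(1)] by (intro card_vimage_inj) auto
          ultimately show "y \<in> {p\<in>I. h p = a}"
            using p(1,3) s(1) by (auto simp: I_def E_def \<phi>_def shape_permute exponents_permute)
        qed
        ultimately show ?thesis
          unfolding N_def using finI by (intro card_inj_on_le) auto
      qed
      define C where "C L' = (of_nat (N (SOME m. m \<in> exponents n \<and> shape n m = L')) :: 'a)" for L'
      have C: "of_nat (N m) = C (shape n m)" if "m \<in> exponents n" for m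
      proof -
        let ?m = "SOME m'. m' \<in> exponents n \<and> shape n m' = shape n m"
        have "?m \<in> exponents n \<and> shape n ?m = shape n m"
          by (rule someI[of _ m]) (simp add: that)
        then have "N m = N ?m" using N_le[of m ?m] N_le[of ?m m] that by simp
        then show ?thesis by (simp add: C_def)
      qed
      \<comment> \<open>As \<open>m0\<close> has exactly \<open>k\<close> nonzero entries, it arises
        from a single pair. The resulting coefficient 1 allows solving for \<open>L\<close> without
        a division, which a subring would not permit.\<close>
      have "p = (supp m0, \<lambda>i. m0 i - 1)" if "p \<in> I" "h p = m0" for p
        using full[OF that(1)] that(2) by (simp add: k_def prod_eq_iff)
      then have "{p\<in>I. h p = m0} = {(supp m0, \<lambda>i. m0 i - 1)}"
        using p0 by blast
      then have "C L = 1" using C[OF m0(1)] m0(2) by (simp add: N_def)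
      have "(\<Sum>S\<in>E. \<Prod>i\<in>S. x i) * monomial_sym n x L0 = (\<Sum>p\<in>I. monomial_val n x (h p))"
        unfolding monomial_sym_def sum_product sum.cartesian_product I_def h_def monomial_val_add
        by (intro sum.cong) (auto simp: E_def monomial_val_indicator)
      also have "\<dots> = (\<Sum>m\<in>h ` I. \<Sum>p\<in>{p\<in>I. h p = m}. monomial_val n x (h p))"
        by (rule sum.image_gen[OF finI])
      also have "\<dots> = (\<Sum>m\<in>h ` I. of_nat (N m) * monomial_val n x m)"
        by (intro sum.cong) (auto simp: N_def)
      also have "\<dots> = (\<Sum>L'\<in>shape n ` h ` I. C L' * monomial_sym n x L')"
      proof (rule symmetric_sum_eq_monomial_sym[of _ n "\<lambda>m. of_nat (N m)" C, OF _ _ C])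
        show "of_nat (N m) = (0::'a)" if "m \<notin> h ` I" for m
        proof -
          have empty: "{p\<in>I. h p = m} = {}" using that by blast
          show ?thesis unfolding N_def empty by simp
        qed
      qed (use finI h_exp in auto)
      also have "\<dots> = monomial_sym n x L + (\<Sum>L'\<in>shape n ` h ` I - {L}. C L' * monomial_sym n x L')"
      proof -
        have "L \<in> shape n ` h ` I" using p0 m0(2) by (metis imageI)
        then show ?thesis using finI \<open>C L = 1\<close> by (subst sum.remove[of _ L]) auto
      qed
      finally have "monomial_sym n x L = (\<Sum>S\<in>E. \<Prod>i\<in>S. x i) * monomial_sym n x L0
          - (\<Sum>L'\<in>shape n ` h ` I - {L}. C L' * monomial_sym n x L')"
        by simp
      moreover have "monomial_sym n x L0 \<in> R"
        using k sumL by (intro less.IH) simp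
      moreover have "monomial_sym n x L' \<in> R" if L': "L' \<in> shape n ` h ` I - {L}" for L'
      proof -
        obtain p where p: "p \<in> I" "L' = shape n (h p)" using L' by auto
        have "k \<le> card (supp (h p))"
          using sub[OF p(1)] card_mono[of "supp (h p)" "fst p"] p(1)
          by (auto simp: supp_def I_def E_def)
        \<comment> \<open>With exactly \<open>k\<close> nonzero entries, lowering them would give
          \<open>L0\<close> by \<open>full\<close>, hence \<open>L'\<close> and \<open>L\<close>
          would agree both after lowering and in their number of zeros.\<close>
        moreover have "card (supp (h p)) \<noteq> k"
        proof
          assume c: "card (supp (h p)) = k"
          have "count L' 0 = count L 0"
            using c unfolding p(2) m0(2)[symmetric] count_shape_0 by (simp add: supp_def k_def)
          moreover have "image_mset (\<lambda>v. v - 1) L' = image_mset (\<lambda>v. v - 1) L"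
            using full(2)[OF p(1) c] p(1) unfolding p(2) L0_def[symmetric] shape_pred[symmetric]
            by (auto simp: I_def)
          ultimately show False using multiset_eq_of_pred_image L' by blast
        qed
        ultimately have "count L' 0 < count L 0"
          using supp_le[of "h p"] unfolding p(2) m0(2)[symmetric] count_shape_0
          by (simp add: supp_def k_def)
        then show ?thesis
          using sum_h[OF p(1)] sumL p(2) by (intro less.IH) simp
      qed
      ultimately show ?thesis
        using e[of k] by (auto simp: E_def C_def intro!: diff_mem mult_mem sum_mem of_nat_mem)
    qed
  qed
qed

text \<open>Over an infinite field the invariance of the function passes to its coefficients, so it
  is a combination over \<open>R\<close> of monomial symmetric functions.\<close>

lemma symmetric_polyfun_mem:
  assumes inf: "infinite (UNIV :: 'a set)" and "polyfun n \<Phi>"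
    and sym: "\<And>\<sigma> x. \<sigma> permutes {..<n} \<Longrightarrow> \<Phi> (x \<circ> \<sigma>) = \<Phi> x"
    and e: "\<And>k. (\<Sum>S\<in>{S. S \<subseteq> {..<n} \<and> card S = k}. \<Prod>i\<in>S. x i) \<in> R"
  shows "\<Phi> x \<in> R"
proof -
  obtain M c where M: "finite M" "M \<subseteq> exponents n" and c: "\<And>m. c m \<in> R"
    and c0: "\<And>m. m \<notin> M \<Longrightarrow> c m = 0" and \<Phi>: "\<And>x. \<Phi> x = (\<Sum>m\<in>M. c m * monomial_val n x m)"
    using assms(2) unfolding polyfun_def by blast
  have c_permute: "c (m \<circ> \<sigma>) = c m" if s: "\<sigma> permutes {..<n}" for m \<sigma>
  proof -
    \<comment> \<open>\<open>W\<close> supports the coefficients of the permuted function; both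
      functions are then written as sums over \<open>M \<union> W\<close> and compared term by
      term.\<close>
    define W where "W = (\<lambda>m. m \<circ> inv_into UNIV \<sigma>) ` M"
    have ss: "\<sigma> \<circ> inv_into UNIV \<sigma> = id" "inv_into UNIV \<sigma> \<circ> \<sigma> = id"
      using permutes_inv_o[OF s] by auto
    have W_iff: "a \<in> W \<longleftrightarrow> a \<circ> \<sigma> \<in> M" for a
    proof
      assume "a \<in> W"
      then show "a \<circ> \<sigma> \<in> M" using ss by (auto simp: W_def o_assoc[symmetric])
    next
      assume "a \<circ> \<sigma> \<in> M"
      then have "a \<circ> \<sigma> \<circ> inv_into UNIV \<sigma> \<in> W" unfolding W_def by blast
      then show "a \<in> W" using ss by (simp add: o_assoc[symmetric])
    qed
    have W: "finite W" "W \<subseteq> exponents n"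
      using M exponents_permute[OF permutes_inv[OF s]] by (auto simp: W_def)
    have "(\<Sum>a\<in>M \<union> W. (c (a \<circ> \<sigma>) - c a) * monomial_val n y a) = 0" for y
    proof -
      have "\<Phi> (y \<circ> \<sigma>) = (\<Sum>a\<in>W. c (a \<circ> \<sigma>) * monomial_val n y a)"
        unfolding \<Phi>
        by (rule sum.reindex_bij_witness[of _ "\<lambda>a. a \<circ> \<sigma>" "\<lambda>a. a \<circ> inv_into UNIV \<sigma>"])
           (auto simp: W_iff o_assoc[symmetric] ss monomial_val_permute[OF s, of y, symmetric])
      also have "\<dots> = (\<Sum>a\<in>M \<union> W. c (a \<circ> \<sigma>) * monomial_val n y a)"
        using M W c0 by (intro sum.mono_neutral_left) (auto simp: W_iff)
      finally have "\<Phi> (y \<circ> \<sigma>) = (\<Sum>a\<in>M \<union> W. c (a \<circ> \<sigma>) * monomial_val n y a)" .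
      moreover have "\<Phi> y = (\<Sum>a\<in>M \<union> W. c a * monomial_val n y a)"
        unfolding \<Phi> using M W c0 by (intro sum.mono_neutral_left) auto
      ultimately show ?thesis
        using sym[OF s, of y] by (simp add: left_diff_distrib sum_subtractf)
    qed
    then have "c (a \<circ> \<sigma>) - c a = 0" if "a \<in> M \<union> W" for a
      using M W that exponents_eqI
      by (intro monomial_val_sum_eq_0_imp[OF inf, of "M \<union> W" n "\<lambda>a. c (a \<circ> \<sigma>) - c a"]) blast+
    then show ?thesis using c0 W_iff by (cases "m \<in> M \<union> W") auto
  qed
  define C where "C L = c (SOME m. m \<in> exponents n \<and> shape n m = L)" for L
  have C: "c m = C (shape n m)" if m: "m \<in> exponents n" for m
  proof -
    let ?m = "SOME m'. m' \<in> exponents n \<and> shape n m' = shape n m"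
    have "?m \<in> exponents n \<and> shape n ?m = shape n m"
      by (rule someI[of _ m]) (simp add: m)
    then obtain \<sigma> where "\<sigma> permutes {..<n}" "m = ?m \<circ> \<sigma>"
      using shape_eq_imp_permutes[of n m ?m] m by metis
    then show ?thesis unfolding C_def using c_permute by metis
  qed
  have "\<Phi> x = (\<Sum>L\<in>shape n ` M. C L * monomial_sym n x L)"
    unfolding \<Phi> by (rule symmetric_sum_eq_monomial_sym[of M n c C x]) (use M C c0 in blast)+
  then show ?thesis using c monomial_sym_mem[OF e] by (auto simp: C_def intro!: sum_mem mult_mem)
qed

end

section \<open>Counting families of disjoint sets\<close>

text \<open>The sets need not cover \<open>A\<close>: for \<open>card A = q ^ k * (q * m)\<close>
  and \<open>q\<close> sets of size \<open>q ^ k\<close> they do so only when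
  \<open>m = 1\<close>.\<close>

definition packings :: "'a set \<Rightarrow> nat \<Rightarrow> nat \<Rightarrow> 'a set set set" where
  "packings A r j = {\<pi>. \<pi> \<subseteq> {B. B \<subseteq> A \<and> card B = r} \<and> disjoint \<pi> \<and> card \<pi> = j}"

lemma finite_packings: "finite A \<Longrightarrow> finite (packings A r j)"
  by (rule finite_subset[of _ "Pow (Pow A)"]) (auto simp: packings_def)

lemma finite_packing: "finite A \<Longrightarrow> \<pi> \<in> packings A r j \<Longrightarrow> finite \<pi>"
  by (rule finite_subset[of _ "Pow A"]) (auto simp: packings_def)

lemma packings_0:
  assumes A: "finite A"
  shows "packings A r 0 = {{}}"
proof -
  have "\<pi> = {}" if "\<pi> \<in> packings A r 0" for \<pi>
    using finite_packing[OF A that] that unfolding packings_def by simp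
  moreover have "{} \<in> packings A r 0" by (simp add: packings_def disjoint_def)
  ultimately show ?thesis by blast
qed

lemma card_Union_packing:
  assumes "finite A" "\<pi> \<in> packings A r j"
  shows "card (\<Union>\<pi>) = j * r"
proof -
  have "card (\<Union>\<pi>) = sum card \<pi>"
    using assms by (intro card_Union_disjoint) (auto simp: packings_def disjoint_def pairwise_def disjnt_def intro: finite_subset)
  then show ?thesis using assms(2) by (auto simp: packings_def subset_iff)
qed

text \<open>Double counting of packings with a distinguished member: remove the member, or add an
  \<open>r\<close>-subset of the uncovered part. Positivity of \<open>r\<close> ensures that the
  added set is new, since the empty set is disjoint from itself.\<close>

lemma card_packings_Suc:
  assumes A: "finite A" and r: "r > 0"
  shows "card (packings A r (Suc j)) * Suc j = card (packings A r j) * ((card A - j * r) choose r)"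
proof -
  let ?L = "SIGMA \<pi>:packings A r (Suc j). \<pi>"
  let ?R = "SIGMA \<pi>:packings A r j. {B. B \<subseteq> A - \<Union>\<pi> \<and> card B = r}"
  have "bij_betw (\<lambda>(\<pi>, B). (\<pi> - {B}, B)) ?L ?R"
  proof (rule bij_betw_byWitness[where f' = "\<lambda>(\<pi>, B). (insert B \<pi>, B)"])
    have notin: "B \<notin> \<pi>" if "B \<subseteq> A - \<Union>\<pi>" "card B = r" for B \<pi>
      using that r by (metis Diff_disjoint Sup_upper card.empty le_inf_iff less_irrefl subset_empty)
    show "\<forall>x\<in>?L. (case case x of (\<pi>, B) \<Rightarrow> (\<pi> - {B}, B) of (\<pi>, B) \<Rightarrow> (insert B \<pi>, B)) = x"
      by auto
    show "\<forall>x\<in>?R. (case case x of (\<pi>, B) \<Rightarrow> (insert B \<pi>, B) of (\<pi>, B) \<Rightarrow> (\<pi> - {B}, B)) = x"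
      using notin by auto
    show "(\<lambda>(\<pi>, B). (\<pi> - {B}, B)) ` ?L \<subseteq> ?R"
      using A by (fastforce simp: packings_def disjoint_def)
    show "(\<lambda>(\<pi>, B). (insert B \<pi>, B)) ` ?R \<subseteq> ?L"
    proof
      fix y assume "y \<in> (\<lambda>(\<pi>, B). (insert B \<pi>, B)) ` ?R"
      then obtain \<pi> B where y: "y = (insert B \<pi>, B)"
        and pi: "\<pi> \<in> packings A r j" and B: "B \<subseteq> A - \<Union>\<pi>" "card B = r" by auto
      have "finite \<pi>" using finite_packing[OF A pi] .
      moreover have "B \<notin> \<pi>" using notin B by simp
      ultimately have "insert B \<pi> \<in> packings A r (Suc j)"
        using pi B by (auto simp: packings_def disjoint_def)
      then show "y \<in> ?L" using y by simp
    qed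
  qed
  then have "card ?L = card ?R" by (rule bij_betw_same_card)
  moreover have "card ?L = card (packings A r (Suc j)) * Suc j"
  proof -
    have "card \<pi> = Suc j" if "\<pi> \<in> packings A r (Suc j)" for \<pi>
      using that by (simp add: packings_def)
    then show ?thesis
      using finite_packings[OF A] finite_packing[OF A] by (subst card_SigmaI) auto
  qed
  moreover have "card {B. B \<subseteq> A - \<Union>\<pi> \<and> card B = r} = (card A - j * r) choose r"
    if "\<pi> \<in> packings A r j" for \<pi>
  proof -
    have "\<Union>\<pi> \<subseteq> A" using that by (auto simp: packings_def)
    then have "card (A - \<Union>\<pi>) = card A - j * r"
      using A card_Union_packing[OF A that] by (simp add: card_Diff_subset finite_subset)
    then show ?thesis using n_subsets[of "A - \<Union>\<pi>" r] A by simp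
  qed
  then have "card ?R = card (packings A r j) * ((card A - j * r) choose r)"
    using A finite_packings[OF A] by (subst card_SigmaI) auto
  ultimately show ?thesis by simp
qed

text \<open>Both sides count ordered packings, chosen one set at a time.\<close>

lemma card_packings_fact:
  assumes "finite A" "r > 0"
  shows "card (packings A r j) * fact j = (\<Prod>i<j. (card A - i * r) choose r)"
proof (induction j)
  case (Suc j)
  have "card (packings A r (Suc j)) * fact (Suc j) = card (packings A r (Suc j)) * Suc j * fact j"
    by (simp only: fact_Suc of_nat_id mult_ac)
  then show ?case unfolding card_packings_Suc[OF assms]
    by (simp add: Suc.IH[symmetric] algebra_simps)
qed (simp add: packings_0 assms)

text \<open>Compare exponents of \<open>q\<close>. Multiplied by \<open>fact q\<close>, the number
  becomes a product of binomial coefficients, of which only that for \<open>i = 0\<close> is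
  divisible by \<open>q\<close>, and exactly once. The factor \<open>q\<close> of
  \<open>fact q\<close> already accounts for it.\<close>

lemma card_packings_not_dvd:
  assumes q: "prime q" and m: "\<not> q dvd m" and A: "finite A" "card A = q ^ k * (q * m)"
  shows "\<not> q dvd card (packings A (q ^ k) q)"
proof
  assume dvd: "q dvd card (packings A (q ^ k) q)"
  have q0: "q > 0" and m0: "m > 0" using q m prime_gt_0_nat by (simp_all, metis dvd_0_right gr0I)
  \<comment> \<open>The binomial lemma behind Sylow's theorem: \<open>q ^ k * u choose q ^ k\<close>
    and \<open>u\<close> contain \<open>q\<close> equally often, here for
    \<open>u = q * m - i\<close>.\<close>
  have mult: "multiplicity q ((card A - i * q ^ k) choose (q ^ k)) = multiplicity q (q * m - i)"
    and pos: "(card A - i * q ^ k) choose (q ^ k) > 0" if "i < q" for i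
  proof -
    have "i < q * m" using that m0 by (metis less_le_trans mult.right_neutral mult_le_mono2 One_nat_def Suc_leI)
    moreover have eq: "card A - i * q ^ k = q ^ k * (q * m - i)" 
      by (simp add: A diff_mult_distrib2 mult.commute)
    ultimately show "multiplicity q ((card A - i * q ^ k) choose (q ^ k)) = multiplicity q (q * m - i)"
      unfolding eq using const_p_fac q by simp
    show "(card A - i * q ^ k) choose (q ^ k) > 0"
      unfolding eq using \<open>i < q * m\<close> by (simp add: Suc_leI)
  qed
  have "q ^ 2 dvd card (packings A (q ^ k) q) * fact q"
    unfolding power2_eq_square using dvd q0 by (intro mult_dvd_mono dvd_fact) auto
  moreover have "card (packings A (q ^ k) q) * fact q = (\<Prod>i<q. (card A - i * q ^ k) choose (q ^ k))"
    using q0 by (intro card_packings_fact A) simp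
  moreover have nz: "(\<Prod>i<q. (card A - i * q ^ k) choose (q ^ k)) \<noteq> 0"
    by (rule gr_implies_not0, rule prod_pos, rule pos) simp
  ultimately have "2 \<le> multiplicity q (\<Prod>i<q. (card A - i * q ^ k) choose (q ^ k))"
    using q by (intro multiplicity_geI) (auto dest: prime_gt_1_nat)
  also have "\<dots> = (\<Sum>i<q. multiplicity q ((card A - i * q ^ k) choose (q ^ k)))"
    using nz q by (intro prime_elem_multiplicity_prod_distrib) (auto simp: image_iff)
  also have "\<dots> = (\<Sum>i<q. multiplicity q (q * m - i))"
    using mult by (intro sum.cong) auto
  also have "\<dots> = (\<Sum>i<q. if i = 0 then 1 else 0)"
  proof (intro sum.cong refl)
    fix i assume "i \<in> {..<q}"
    show "multiplicity q (q * m - i) = (if i = 0 then 1 else 0)"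
    proof (cases "i = 0")
      case True
      then show ?thesis using q m m0 by (simp add: prime_elem_multiplicity_mult_distrib not_dvd_imp_multiplicity_0)
    next
      case False
      then have "\<not> q dvd q * m - i"
        using \<open>i \<in> {..<q}\<close> m0
        by (metis dvd_diffD1 dvd_triv_left lessThan_iff gr0I nat_dvd_not_less less_imp_le_nat less_le_trans mult.right_neutral mult_le_mono2 One_nat_def Suc_leI)
      then show ?thesis using False by (simp add: not_dvd_imp_multiplicity_0)
    qed
  qed
  also have "\<dots> = 1" using q0 by simp
  finally show False by simp
qed

section \<open>Additive sets of natural numbers\<close>

text \<open>The least positive difference \<open>g\<close> of two members divides every member. If
  \<open>g = 1\<close>, then \<open>D\<close> contains two consecutive numbers and so all large
  ones.\<close>

lemma additive_nat_set_cofinite_or_prime_dvd: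
  fixes D :: "nat set"
  assumes D0: "0 \<in> D" and Dadd: "\<And>a b. a \<in> D \<Longrightarrow> b \<in> D \<Longrightarrow> a + b \<in> D"
  shows "(\<exists>N. \<forall>m\<ge>N. m \<in> D) \<or> (\<exists>q. prime q \<and> (\<forall>d\<in>D. q dvd d))"
proof (cases "D \<subseteq> {0}")
  case True
  then have "\<forall>d\<in>D. 2 dvd d" by auto
  then show ?thesis using two_is_prime_nat by blast
next
  case False
  define P where "P g \<longleftrightarrow> g > 0 \<and> (\<exists>b\<in>D. b + g \<in> D)" for g
  obtain d where d: "d \<in> D" "d \<noteq> 0" using False by auto
  have "P d" unfolding P_def using d D0 by (metis add_0 gr0I)
  define g where "g = (LEAST g. P g)"
  have "P g" unfolding g_def using \<open>P d\<close> by (rule LeastI)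
  then obtain b where b: "g > 0" "b \<in> D" "b + g \<in> D" unfolding P_def by auto
  have Dmult: "u * a \<in> D" if "a \<in> D" for u a :: nat
    using that by (induction u) (auto intro: D0 Dadd)
  have gdvd: "g dvd c" if "c \<in> D" for c
  proof (rule ccontr)
    assume "\<not> g dvd c"
    then have "c mod g > 0" by (simp add: mod_greater_zero_iff_not_dvd)
    \<comment> \<open>The remainder is itself a difference of two members of \<open>D\<close>,
      against the minimality of \<open>g\<close>.\<close>
    moreover have "(c div g) * (b + g) + c mod g = c + (c div g) * b"
      using div_mult_mod_eq[of c g] by (simp add: algebra_simps)
    then have "(c div g) * (b + g) + c mod g \<in> D"
      using Dadd Dmult b that by simp
    ultimately have "P (c mod g)" unfolding P_def using Dmult b by blast
    then have "g \<le> c mod g" unfolding g_def by (rule Least_le)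
    then show False using b(1) mod_less_divisor[of g c] by linarith
  qed
  show ?thesis
  proof (cases "g = 1")
    case False
    then obtain q where "prime q" "q dvd g" using prime_factor_nat by blast
    then show ?thesis using gdvd dvd_trans by blast
  next
    case True
    \<comment> \<open>Combine \<open>m mod b\<close> copies of \<open>b + 1\<close> with
      \<open>m div b - m mod b\<close> copies of \<open>b\<close>; the bound \<open>b * b\<close>
      keeps this subtraction from being truncated.\<close>
    have "m \<in> D" if m: "m \<ge> b * b" for m
    proof (cases "b = 0")
      case True
      then show ?thesis using Dmult[of 1 m] b \<open>g = 1\<close> by simp
    next
      case False
      have "m mod b \<le> m div b"
        using m False by (metis div_le_mono nonzero_mult_div_cancel_right less_le_trans
            mod_less_divisor order.strict_implies_order gr0I)
      then have "(m div b - m mod b) * b + (m mod b) * (b + 1) = m"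
        using div_mult_mod_eq[of m b]
        by (simp add: algebra_simps diff_mult_distrib2)
      moreover have "(m div b - m mod b) * b + (m mod b) * (b + 1) \<in> D"
        using Dadd[OF Dmult Dmult, of b "b + 1"] b \<open>g = 1\<close> by simp
      ultimately show ?thesis by simp
    qed
    then show ?thesis by blast
  qed
qed

section \<open>Factors with coefficients in a subfield\<close>

locale subfield_of = unital_subring +
  assumes divide_mem: "a \<in> R \<Longrightarrow> b \<in> R \<Longrightarrow> a / b \<in> R"
begin

text \<open>Induction on the degree: subtract the value at one good point \<open>t0\<close> and
  divide by \<open>X - t0\<close>. The quotient has values in \<open>R\<close> at all other good
  points.\<close>

lemma coeff_mem_of_infinite_values:
  "infinite {t\<in>R. poly p t \<in> R} \<Longrightarrow> coeff p i \<in> R"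
proof (induction "degree p" arbitrary: p i)
  case 0
  then obtain a where p: "p = [:a:]" using degree_eq_zeroE by metis
  obtain t where "t \<in> {t\<in>R. poly p t \<in> R}"
    using 0(2) by (metis (no_types, lifting) finite.emptyI ex_in_conv)
  then show ?case using p by (auto simp: coeff_pCons zero_mem split: nat.split)
next
  case (Suc d)
  obtain t0 where t0: "t0 \<in> {t\<in>R. poly p t \<in> R}"
    using Suc.prems by (metis (no_types, lifting) finite.emptyI ex_in_conv)
  define q where "q = synthetic_div p t0"
  have p: "p = [:- t0, 1:] * q + [:poly p t0:]"
    unfolding q_def by (rule synthetic_div_correct'[symmetric])
  have "poly q t \<in> R" if "t \<in> {t\<in>R. poly p t \<in> R} - {t0}" for t
  proof -
    have "poly p t = (t - t0) * poly q t + poly p t0"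
      by (subst p) (simp add: algebra_simps)
    then have "poly q t = (poly p t - poly p t0) / (t - t0)"
      using that by (simp add: field_simps)
    then show ?thesis using that t0 by (auto intro!: divide_mem diff_mem)
  qed
  then have "{t\<in>R. poly p t \<in> R} - {t0} \<subseteq> {t\<in>R. poly q t \<in> R}" by blast
  moreover have "infinite ({t\<in>R. poly p t \<in> R} - {t0})" using Suc.prems by simp
  ultimately have "infinite {t\<in>R. poly q t \<in> R}" using finite_subset by blast
  moreover have "d = degree q" using Suc.hyps(2) by (simp add: q_def degree_synthetic_div)
  ultimately have q: "coeff q j \<in> R" for j using Suc.hyps(1) by blast
  have "coeff p i = (case i of 0 \<Rightarrow> poly p t0 | Suc j \<Rightarrow> coeff q j) - t0 * coeff q i"
    by (subst p) (simp add: coeff_pCons split: nat.split)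
  moreover have "(case i of 0 \<Rightarrow> poly p t0 | Suc j \<Rightarrow> coeff q j) \<in> R"
    using q t0 by (cases i) auto
  ultimately show ?case using q t0 by (auto intro!: diff_mem mult_mem)
qed

text \<open>Vieta: up to sign, the sum is the coefficient of degree \<open>n - k\<close>; for
  \<open>k > n\<close> it is empty.\<close>

lemma elementary_symmetric_mem:
  fixes x :: "nat \<Rightarrow> 'a"
  assumes "\<And>j. coeff (\<Prod>i<n. [:- x i, 1:]) j \<in> R"
  shows "(\<Sum>S\<in>{S. S \<subseteq> {..<n} \<and> card S = k}. \<Prod>i\<in>S. x i) \<in> R"
proof (cases "k \<le> n")
  case True
  let ?e = "\<Sum>S\<in>{S. S \<subseteq> {..<n} \<and> card S = k}. \<Prod>i\<in>S. x i"
  have "(\<Prod>i<n. [:- x i, 1:]) = (\<Prod>i<n. [:- x i:] + monom 1 1)"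
    by (simp add: monom_altdef)
  also have "\<dots> = (\<Sum>S\<in>Pow {..<n}. (\<Prod>i\<in>S. [:- x i:]) * (\<Prod>i\<in>{..<n} - S. monom 1 1))"
    by (rule prod_add) simp
  also have "\<dots> = (\<Sum>S\<in>Pow {..<n}. monom (\<Prod>i\<in>S. - x i) (n - card S))"
  proof (intro sum.cong refl)
    fix S assume "S \<in> Pow {..<n}"
    then have "card ({..<n} - S) = n - card S"
      by (simp add: card_Diff_subset finite_subset)
    moreover have "(\<Prod>i\<in>S. [:- x i:]) = [:\<Prod>i\<in>S. - x i:]"
      by (induction S rule: infinite_finite_induct) auto
    ultimately show "(\<Prod>i\<in>S. [:- x i:]) * (\<Prod>i\<in>{..<n} - S. monom 1 1) = monom (\<Prod>i\<in>S. - x i) (n - card S)"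
      by (simp add: monom_power smult_monom)
  qed
  finally have "coeff (\<Prod>i<n. [:- x i, 1:]) (n - k) =
      (\<Sum>S\<in>Pow {..<n}. if n - card S = n - k then \<Prod>i\<in>S. - x i else 0)"
    by (simp add: coeff_sum)
  also have "\<dots> = (\<Sum>S\<in>{S. S \<subseteq> {..<n} \<and> card S = k}. \<Prod>i\<in>S. - x i)"
  proof (rule sum.mono_neutral_cong_right)
    \<comment> \<open>With \<open>k \<le> n\<close> and this bound, the truncated differences
      \<open>n - card S\<close> and \<open>n - k\<close> agree only if
      \<open>card S = k\<close>.\<close>
    have le: "card S \<le> n" if "S \<subseteq> {..<n}" for S using card_mono[OF _ that] by simp
    show "\<forall>S\<in>Pow {..<n} - {S. S \<subseteq> {..<n} \<and> card S = k}.
        (if n - card S = n - k then \<Prod>i\<in>S. - x i else 0) = 0"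
    proof
      fix S assume "S \<in> Pow {..<n} - {S. S \<subseteq> {..<n} \<and> card S = k}"
      then have "n - card S \<noteq> n - k" using le[of S] True by auto
      then show "(if n - card S = n - k then \<Prod>i\<in>S. - x i else 0) = 0" by simp
    qed
  qed auto
  also have "\<dots> = (-1) ^ k * ?e"
    unfolding sum_distrib_left by (intro sum.cong) (auto simp: prod_uminus)
  finally have eq: "coeff (\<Prod>i<n. [:- x i, 1:]) (n - k) = (-1) ^ k * ?e" .
  have "?e \<in> {coeff (\<Prod>i<n. [:- x i, 1:]) (n - k), - coeff (\<Prod>i<n. [:- x i, 1:]) (n - k)}"
    unfolding eq by (cases "even k") auto
  then show ?thesis using assms[of "n - k"] uminus_mem by auto
next
  case False
  then have "{S. S \<subseteq> {..<n} \<and> card S = k} = {}"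
    using card_mono[of "{..<n}"] by fastforce
  then show ?thesis unfolding \<open>_ = {}\<close> by (simp add: zero_mem)
qed

end

lemma packings_image:
  assumes s: "\<sigma> permutes A" and p: "\<pi> \<in> packings A r j"
  shows "(`) \<sigma> ` \<pi> \<in> packings A r j"
proof -
  have inj: "inj \<sigma>" using s by (rule permutes_inj)
  then have "inj_on ((`) \<sigma>) \<pi>" by (auto simp: inj_on_def inj_image_eq_iff)
  moreover have card_B: "card (\<sigma> ` B) = card B" for B
    using inj by (meson card_image inj_on_subset subset_UNIV)
  moreover have sub_B: "\<sigma> ` B \<subseteq> A" if "B \<subseteq> A" for B
    using that permutes_image[OF s] by blast
  moreover have "disjoint ((`) \<sigma> ` \<pi>)"
    using p inj_on_subset[OF inj] by (intro disjoint_image) (auto simp: packings_def)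
  moreover have "(`) \<sigma> ` \<pi> \<subseteq> {B. B \<subseteq> A \<and> card B = r}"
  proof (rule image_subsetI)
    fix B assume "B \<in> \<pi>"
    then have "B \<subseteq> A" "card B = r" using p by (auto simp: packings_def)
    then show "\<sigma> ` B \<in> {B. B \<subseteq> A \<and> card B = r}"
      using card_B sub_B by simp
  qed
  ultimately show ?thesis
    using p by (simp add: packings_def card_image)
qed

text \<open>The resolvent argument. \<open>root\<close> is applied to the resolvent, whose degree is
  the number of packings, and \<open>root_q\<close> to the polynomial of degree \<open>q\<close>
  attached to one packing.\<close>

lemma (in subfield_of) factor_of_prime_power_degree:
  assumes inf: "infinite R" and q: "prime q" and m: "\<not> q dvd m" and n: "n = q ^ k * (q * m)"
    and coeffs: "\<And>j. coeff (\<Prod>i<n. [:- a i, 1:]) j \<in> R"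
    and root: "\<And>p. (\<And>j. coeff p j \<in> R) \<Longrightarrow> \<not> q dvd degree p \<Longrightarrow> \<exists>y\<in>R. poly p y = 0"
    and root_q: "\<And>p. (\<And>j. coeff p j \<in> R) \<Longrightarrow> degree p = q \<Longrightarrow> \<exists>y\<in>R. poly p y = 0"
  obtains B where "B \<subseteq> {..<n}" "card B = q ^ k" "\<And>j. coeff (\<Prod>i\<in>B. [:- a i, 1:]) j \<in> R"
proof -
  define \<P> where "\<P> = packings {..<n} (q ^ k) q"
  have fin: "finite \<P>" unfolding \<P>_def by (rule finite_packings) simp
  have deg: "degree (\<Prod>i\<in>I. [:- f i, 1:]) = card I" for I :: "'i set" and f :: "'i \<Rightarrow> 'a"
    by (subst degree_prod_eq_sum_degree) auto
  define F where "F s t \<pi> x = (\<Prod>B\<in>\<pi>. s - (\<Prod>i\<in>B. t - x i))" for s t \<pi> and x :: "nat \<Rightarrow> 'a"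
  have F_mem: "\<exists>\<pi>\<in>\<P>. F s t \<pi> a \<in> R" if st: "s \<in> R" "t \<in> R" for s t
  proof -
    define Q where "Q x = (\<Prod>\<pi>\<in>\<P>. [:- F s t \<pi> x, 1:])" for x
    have "coeff (Q a) j \<in> R" for j
    proof (rule symmetric_polyfun_mem[where \<Phi> = "\<lambda>x. coeff (Q x) j"])
      show "infinite (UNIV :: 'a set)" using inf infinite_super[OF subset_UNIV] by blast
      show "polyfun n (\<lambda>x. coeff (Q x) j)"
        unfolding Q_def F_def
        by (intro polyfun_coeff_prod_linear polyfun_prod polyfun_diff polyfun_const polyfun_var st)
           (auto simp: \<P>_def packings_def)
      show "coeff (Q (x \<circ> \<sigma>)) j = coeff (Q x) j" if s: "\<sigma> permutes {..<n}" for \<sigma> x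
      proof -
        have F_permute: "F s t \<pi> (x \<circ> \<sigma>) = F s t ((`) \<sigma> ` \<pi>) x" for \<pi>
        proof -
          have "inj_on ((`) \<sigma>) \<pi>" using permutes_inj[OF s] by (auto simp: inj_on_def inj_image_eq_iff)
          then show ?thesis
            unfolding F_def using permutes_inj_on[OF s] by (simp add: prod.reindex)
        qed
        \<comment> \<open>Permuting the variables permutes the packings, hence only the factors of
          the resolvent.\<close>
        have "Q (x \<circ> \<sigma>) = Q x"
          unfolding Q_def
          by (rule prod.reindex_bij_witness[of _ "(`) ((`) (inv_into UNIV \<sigma>))" "(`) ((`) \<sigma>)"])
             (auto simp: \<P>_def F_permute image_image permutes_inverses[OF s] intro!: packings_image s permutes_inv)
        then show ?thesis by simp
      qed
      show "(\<Sum>S\<in>{S. S \<subseteq> {..<n} \<and> card S = k}. \<Prod>i\<in>S. a i) \<in> R" for k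
        using coeffs by (rule elementary_symmetric_mem)
    qed
    moreover have "\<not> q dvd degree (Q a)"
      unfolding Q_def deg \<P>_def using card_packings_not_dvd[OF q m, of "{..<n}" k] n by simp
    ultimately obtain y where "y \<in> R" "poly (Q a) y = 0" using root by blast
    then show ?thesis using fin by (auto simp: Q_def poly_prod)
  qed
  have "\<exists>B\<in>{B. B \<subseteq> {..<n} \<and> card B = q ^ k}. (\<Prod>i\<in>B. t - a i) \<in> R" if t: "t \<in> R" for t
  proof -
    \<comment> \<open>There are finitely many packings but infinitely many \<open>s\<close>, so one
      packing serves infinitely many of them.\<close>
    obtain \<pi> where \<pi>: "\<pi> \<in> \<P>" "infinite {s\<in>R. F s t \<pi> a \<in> R}"
      using pigeonhole_infinite_rel[OF inf fin, of "\<lambda>s \<pi>. F s t \<pi> a \<in> R"] F_mem t by blast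
    define G where "G = (\<Prod>B\<in>\<pi>. [:- (\<Prod>i\<in>B. t - a i), 1:])"
    have "poly G s = F s t \<pi> a" for s by (simp add: G_def F_def poly_prod)
    then have "coeff G j \<in> R" for j
      using \<pi>(2) coeff_mem_of_infinite_values[of G] by simp
    moreover have "degree G = q"
      using \<pi>(1) unfolding G_def deg by (simp add: \<P>_def packings_def)
    ultimately obtain y where y: "y \<in> R" "poly G y = 0" using root_q by blast
    have "finite \<pi>" using finite_packing \<pi>(1) unfolding \<P>_def by blast
    then obtain B where "B \<in> \<pi>" "y = (\<Prod>i\<in>B. t - a i)"
      using y(2) by (auto simp: G_def poly_prod)
    then show ?thesis using \<pi>(1) y(1) by (auto simp: \<P>_def packings_def)
  qed
  then obtain B where B: "B \<subseteq> {..<n}" "card B = q ^ k" "infinite {t\<in>R. (\<Prod>i\<in>B. t - a i) \<in> R}"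
    using pigeonhole_infinite_rel[OF inf, of "{B. B \<subseteq> {..<n} \<and> card B = q ^ k}"
        "\<lambda>t B. (\<Prod>i\<in>B. t - a i) \<in> R"] by auto
  have "coeff (\<Prod>i\<in>B. [:- a i, 1:]) j \<in> R" for j
    using B(3) by (intro coeff_mem_of_infinite_values) (simp add: poly_prod)
  with B(1,2) show ?thesis by (rule that)
qed

section \<open>Descent from the algebraic closure to the field\<close>

lemma map_poly_to_ac_mult: "map_poly to_ac (p * q) = map_poly to_ac p * map_poly to_ac q"
  by (rule poly_eqI) (simp add: coeff_map_poly coeff_mult to_ac_sum)

lemma map_poly_to_ac_add: "map_poly to_ac (p + q) = map_poly to_ac p + map_poly to_ac q"
  by (rule poly_eqI) (simp add: coeff_map_poly)

lemma degree_map_poly_to_ac [simp]: "degree (map_poly to_ac p) = degree p"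
  by (rule degree_map_poly) simp

lemma poly_map_poly_to_ac: "poly (map_poly to_ac p) (to_ac x) = to_ac (poly p x)"
  by (induction p) (auto simp: map_poly_pCons)

lemma map_poly_to_ac_of_coeffs:
  assumes "\<And>j. coeff P j \<in> range to_ac"
  obtains p where "P = map_poly to_ac p"
proof
  show "P = map_poly to_ac (map_poly of_ac P)"
    using assms by (intro poly_eqI) (auto simp: coeff_map_poly to_ac_of_ac)
qed

text \<open>Division with remainder over the small field remains one over the closure, where the
  remainder is divisible by \<open>g\<close> but of smaller degree.\<close>

lemma map_poly_to_ac_dvd_imp:
  fixes f g :: "'a::field poly"
  assumes "map_poly to_ac g dvd map_poly to_ac f"
  shows "g dvd f"
proof (rule ccontr)
  assume ndvd: "\<not> g dvd f"
  then have r: "f mod g \<noteq> 0" by (simp add: mod_eq_0_iff_dvd)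
  have "map_poly to_ac f = map_poly to_ac g * map_poly to_ac (f div g) + map_poly to_ac (f mod g)"
    by (metis map_poly_to_ac_add map_poly_to_ac_mult mult_div_mod_eq)
  then have "map_poly to_ac g dvd map_poly to_ac (f mod g)"
    using assms by (metis dvd_add_right_iff dvd_triv_left)
  moreover have "map_poly to_ac (f mod g) \<noteq> 0"
    using r by (simp add: map_poly_eq_0_iff)
  ultimately have "degree (map_poly to_ac g) \<le> degree (map_poly to_ac (f mod g))"
    by (rule dvd_imp_degree_le)
  moreover have "g \<noteq> 0"
    using assms ndvd by (auto simp: map_poly_eq_0_iff)
  ultimately show False using degree_mod_less[of g f] r by simp
qed

lemma subfield_of_range_to_ac: "subfield_of (range (to_ac :: 'a::field \<Rightarrow> 'a alg_closure))"
proof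
  fix x y :: "'a alg_closure" assume "x \<in> range to_ac" "y \<in> range to_ac"
  then obtain u v where uv: "x = to_ac u" "y = to_ac v" by auto
  show "x - y \<in> range to_ac" unfolding uv by (metis to_ac_diff rangeI)
  show "x * y \<in> range to_ac" unfolding uv by (metis to_ac_mult rangeI)
  show "x / y \<in> range to_ac" unfolding uv by (metis to_ac_divide rangeI)
qed (metis to_ac_1 rangeI)

text \<open>The factor found over the closure descends to the field, and its degree
  \<open>q ^ k\<close> lies strictly between 0 and \<open>degree f\<close>.\<close>

lemma irreducible_degree_eq_prime_power:
  fixes f :: "'a::field poly"
  assumes inf: "infinite (UNIV :: 'a set)" and q: "prime q"
    and root: "\<And>p :: 'a poly. \<not> q dvd degree p \<Longrightarrow> \<exists>x. poly p x = 0"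
    and root_q: "\<And>p :: 'a poly. degree p = q \<Longrightarrow> \<exists>x. poly p x = 0"
    and f: "q dvd degree f" "degree f > 0"
  shows "\<not> irreducible f"
proof
  assume irr: "irreducible f"
  define n where "n = degree f"
  have f0: "f \<noteq> 0" using f by auto
  interpret subfield_of "range (to_ac :: 'a \<Rightarrow> 'a alg_closure)" by (rule subfield_of_range_to_ac)
  \<comment> \<open>One factor \<open>q\<close> of \<open>n\<close> is kept apart as the number of
    sets in a packing. If \<open>k = 0\<close>, the sets are singletons and the factor found is
    linear.\<close>
  define k where "k = multiplicity q n - 1"
  have mult: "multiplicity q n > 0"
    using f q unfolding n_def by (subst prime_multiplicity_gt_zero_iff) auto
  obtain m where m: "n = q ^ multiplicity q n * m" "\<not> q dvd m"
    using multiplicity_decompose'[of n q] f q unfolding n_def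
    by (metis not_prime_unit neq0_conv)
  then have n: "n = q ^ k * (q * m)"
    using mult unfolding k_def by (metis Suc_diff_1 mult.assoc power_Suc2)
  define h where "h = smult (inverse (lead_coeff f)) f"
  obtain A where A: "size A = n" "map_poly to_ac f = smult (lead_coeff (map_poly to_ac f)) (\<Prod>x\<in>#A. [:-x, 1:])"
    using alg_closed_imp_factorization[of "map_poly to_ac f"] f0 by (auto simp: n_def map_poly_eq_0_iff)
  obtain xs where xs: "A = mset xs" by (metis ex_mset)
  define a where "a i = xs ! i" for i
  have "(\<Prod>x\<in>#A. [:-x, 1:]) = (\<Prod>i<n. [:- a i, 1:])"
    using A(1) unfolding xs a_def
    by (simp add: prod_mset_prod_list prod.list_conv_set_nth atLeast0LessThan flip: mset_map)
  then have fa: "map_poly to_ac f = smult (to_ac (lead_coeff f)) (\<Prod>i<n. [:- a i, 1:])"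
    using A(2) by (simp add: coeff_map_poly)
  have ha: "(\<Prod>i<n. [:- a i, 1:]) = map_poly to_ac h"
    unfolding h_def using f0 fa by (simp add: map_poly_smult)
  have "infinite (range (to_ac :: 'a \<Rightarrow> 'a alg_closure))"
    using inf inj_to_ac finite_imageD by blast
  moreover have "coeff (\<Prod>i<n. [:- a i, 1:]) j \<in> range to_ac" for j
    unfolding ha by (simp add: coeff_map_poly)
  moreover have "\<exists>y\<in>range to_ac. poly P y = 0"
    if P: "\<And>j. coeff P j \<in> range to_ac" "\<not> q dvd degree P \<or> degree P = q" for P :: "'a alg_closure poly"
  proof -
    obtain p where p: "P = map_poly to_ac p" using map_poly_to_ac_of_coeffs[OF P(1)] by metis
    then obtain x where "poly p x = 0" using root root_q P(2) by auto
    then show ?thesis unfolding p using poly_map_poly_to_ac[of p x] by auto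
  qed
  ultimately obtain B where B: "B \<subseteq> {..<n}" "card B = q ^ k"
    "\<And>j. coeff (\<Prod>i\<in>B. [:- a i, 1:]) j \<in> range to_ac"
    using factor_of_prime_power_degree[OF _ q m(2) n] by metis
  obtain g where g: "(\<Prod>i\<in>B. [:- a i, 1:]) = map_poly to_ac g"
    using map_poly_to_ac_of_coeffs[OF B(3)] by metis
  have "map_poly to_ac g dvd map_poly to_ac h"
    unfolding g[symmetric] ha[symmetric] using B(1) by (intro prod_dvd_prod_subset) auto
  then have "g dvd h" by (rule map_poly_to_ac_dvd_imp)
  then have "g dvd f" unfolding h_def using f0 by (simp add: dvd_smult_iff)
  then obtain c where c: "f = g * c" by auto
  have "degree g = card B"
    using arg_cong[OF g, of degree] by (simp add: degree_prod_eq_sum_degree)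
  then have degg: "degree g = q ^ k" using B(2) by simp
  have "q ^ k > 0" using q by (simp add: prime_gt_0_nat)
  have "m > 0" using m(2) by (auto intro: gr0I)
  then have "q ^ k < n"
    using \<open>q ^ k > 0\<close> prime_gt_1_nat[OF q] unfolding n
    by (metis One_nat_def Suc_leI less_le_trans mult.right_neutral mult_le_mono2 nat_mult_less_cancel1)
  moreover have "degree f = degree g + degree c"
    using c f0 by (auto intro: degree_mult_eq)
  moreover have "g dvd 1 \<or> c dvd 1" using irreducibleD[OF irr c] .
  then have "degree g = 0 \<or> degree c = 0" by (auto dest: dvd_imp_degree_le)
  ultimately show False using degg \<open>q ^ k > 0\<close> by (auto simp: n_def)
qed

section \<open>Polynomials of odd degree\<close>

lemma irreducible_root_imp_degree_1:
  fixes f :: "'a::field poly"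
  assumes "irreducible f" "poly f x = 0"
  shows "degree f = 1"
proof -
  obtain g where g: "f = [:- x, 1:] * g"
    using assms(2) poly_eq_0_iff_dvd by (metis dvdE)
  then have "g dvd 1"
    using irreducibleD[OF assms(1) g] is_unit_iff_degree[of "[:- x, 1:]"] by auto
  moreover have "g \<noteq> 0" using assms(1) g by auto
  ultimately have "g \<noteq> 0" "degree g = 0" by (simp_all add: is_unit_iff_degree)
  then show ?thesis unfolding g by (subst degree_mult_eq) auto
qed

text \<open>Add 1 to a multiple of the polynomial vanishing at all field elements. The degrees
  obtained include consecutive numbers, so they have no common prime factor.\<close>

lemma rootless_poly_finite_field:
  assumes "finite (UNIV :: 'a::field set)"
  shows "\<exists>p :: 'a poly. degree p = card (UNIV :: 'a set) + j \<and> (\<forall>x. poly p x \<noteq> 0)"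
proof -
  define P :: "'a poly" where "P = (\<Prod>a\<in>UNIV. [:- a, 1:]) * monom 1 j"
  have "degree (\<Prod>a\<in>(UNIV :: 'a set). [:- a, 1:]) = card (UNIV :: 'a set)"
    by (simp add: degree_prod_eq_sum_degree)
  then have "degree P = card (UNIV :: 'a set) + j"
    unfolding P_def using assms by (subst degree_mult_eq) (auto simp: degree_monom_eq)
  moreover have "card (UNIV :: 'a set) > 0" using assms by (simp add: card_gt_0_iff)
  ultimately have "degree (P + 1) = card (UNIV :: 'a set) + j"
    by (subst degree_add_eq_left) auto
  moreover have "poly (P + 1) x \<noteq> 0" for x
  proof -
    have "poly P x = 0" unfolding P_def using assms by (auto simp: poly_prod)
    then show ?thesis by simp
  qed
  ultimately show ?thesis by blast
qed

text \<open>Strong induction: of two factors whose degrees have an odd sum, one has odd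
  degree.\<close>

lemma odd_degree_has_root:
  fixes p :: "'a::field poly"
  assumes red: "\<And>p :: 'a poly. odd (degree p) \<Longrightarrow> degree p > 1 \<Longrightarrow> \<not> irreducible p"
    and "odd (degree p)"
  shows "\<exists>x. poly p x = 0"
  using assms(2)
proof (induction "degree p" arbitrary: p rule: less_induct)
  case less
  have p0: "p \<noteq> 0" using less.prems by auto
  show ?case
  proof (cases "degree p = 1")
    case True
    then obtain a b where "p = [:a, b:]" "b \<noteq> 0"
      by (metis degree1_coeffs)
    then have "poly p (- a / b) = 0" by simp
    then show ?thesis ..
  next
    case False
    then have "degree p > 1" using less.prems by (cases "degree p") auto
    then have "\<not> irreducible p" "\<not> p dvd 1"
      using red less.prems p0 by (auto simp: is_unit_iff_degree)
    then obtain a b where ab: "p = a * b" "\<not> a dvd 1" "\<not> b dvd 1"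
      using p0 irreducibleI by blast
    then have nz: "a \<noteq> 0" "b \<noteq> 0" using p0 by auto
    then have deg: "degree p = degree a + degree b" "degree a > 0" "degree b > 0"
      using ab by (auto simp: degree_mult_eq is_unit_iff_degree)
    then have "odd (degree a) \<or> odd (degree b)" using less.prems by auto
    then have "(\<exists>x. poly a x = 0) \<or> (\<exists>x. poly b x = 0)" using less.hyps[of a] less.hyps[of b] deg by auto
    then show ?thesis unfolding ab(1) by auto
  qed
qed

text \<open>Products of rootless polynomials are rootless, so their degrees form a semigroup; it
  contains \<open>degree f\<close> but, under the contrary assumption, no odd prime.\<close>

lemma irreducible_odd_degree_imp_rootless_prime_degree:
  fixes f :: "'a::field poly"
  assumes "irreducible f" "odd (degree f)" "degree f > 1"
  shows "\<exists>p :: 'a poly. prime (degree p) \<and> degree p \<noteq> 2 \<and> (\<forall>x. poly p x \<noteq> 0)"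
proof (rule ccontr)
  assume "\<not> ?thesis"
  then have root: "\<exists>x. poly p x = 0" if "prime (degree p)" "degree p \<noteq> 2" for p :: "'a poly"
    using that by blast
  define D where "D = {degree p | p :: 'a poly. \<forall>x. poly p x \<noteq> 0}"
  have D0: "0 \<in> D"
    unfolding D_def by (auto intro: exI[of _ 1])
  have "\<forall>x. poly f x \<noteq> 0" using irreducible_root_imp_degree_1[OF assms(1)] assms(3) by auto
  then have fD: "degree f \<in> D" unfolding D_def by blast
  have D_add: "a + b \<in> D" if ab: "a \<in> D" "b \<in> D" for a b
  proof -
    obtain u v where uv: "a = degree u" "b = degree v"
      "\<forall>x. poly u x \<noteq> (0 :: 'a)" "\<forall>x. poly v x \<noteq> (0 :: 'a)"
      using ab by (auto simp: D_def)
    then have "u \<noteq> 0" "v \<noteq> 0" by force+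
    then have "a + b = degree (u * v)" unfolding uv by (simp add: degree_mult_eq)
    then show ?thesis using uv unfolding D_def by (auto intro!: exI[of _ "u * v"])
  qed
  have "\<not> (\<forall>m\<ge>N. m \<in> D)" for N
  proof
    assume N: "\<forall>m\<ge>N. m \<in> D"
    \<comment> \<open>The bound \<open>max N 2\<close> makes the prime both a member of
      \<open>D\<close> and different from 2.\<close>
    obtain l where l: "prime l" "l > max N 2" using bigger_prime by blast
    then have "l \<in> D" using N by simp
    then obtain p where "l = degree p" "\<forall>x. poly p x \<noteq> (0 :: 'a)" by (auto simp: D_def)
    then show False using root[of p] l by auto
  qed
  then obtain q where q: "prime q" "\<And>d. d \<in> D \<Longrightarrow> q dvd d"
    using additive_nat_set_cofinite_or_prime_dvd[OF D0 D_add] by blast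
  have qf: "q dvd degree f" using q(2) fD .
  have "q \<noteq> 2" using qf assms(2) by auto
  have "infinite (UNIV :: 'a set)"
  proof
    assume fin: "finite (UNIV :: 'a set)"
    have "card (UNIV :: 'a set) + j \<in> D" for j
      using rootless_poly_finite_field[OF fin, of j] by (simp add: D_def) metis
    then have "q dvd card (UNIV :: 'a set) + 0" "q dvd card (UNIV :: 'a set) + 1"
      using q(2) by blast+
    then have "q dvd 1" by (metis add_0_right dvd_add_right_iff)
    then show False using q(1) by (simp add: prime_nat_iff)
  qed
  moreover have "\<exists>x. poly p x = 0" if "\<not> q dvd degree p" for p :: "'a poly"
    using that q(2) unfolding D_def by blast
  moreover have "\<exists>x. poly p x = 0" if "degree p = q" for p :: "'a poly"
    using root that q(1) \<open>q \<noteq> 2\<close> by auto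
  ultimately have "\<not> irreducible f"
    using qf assms(3) q(1) by (intro irreducible_degree_eq_prime_power) auto
  then show False using assms(1) by contradiction
qed

theorem theorem5p2:
  shows "(\<forall>p :: 'a :: field poly. odd (degree p) \<and> degree p > 1 \<longrightarrow> \<not> irreducible p) \<longleftrightarrow>
         (\<forall>p :: 'a poly. prime (degree p) \<and> degree p \<noteq> 2 \<longrightarrow> (\<exists>x :: 'a. poly p x = 0))"
proof
  assume red: "\<forall>p :: 'a poly. odd (degree p) \<and> degree p > 1 \<longrightarrow> \<not> irreducible p"
  show "\<forall>p :: 'a poly. prime (degree p) \<and> degree p \<noteq> 2 \<longrightarrow> (\<exists>x. poly p x = 0)"
  proof (intro allI impI)
    fix p :: "'a poly" assume "prime (degree p) \<and> degree p \<noteq> 2"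
    then have "odd (degree p)" using prime_odd_nat[of "degree p"] prime_ge_2_nat[of "degree p"] by auto
    then show "\<exists>x. poly p x = 0" using red odd_degree_has_root[of p] by blast
  qed
next
  assume "\<forall>p :: 'a poly. prime (degree p) \<and> degree p \<noteq> 2 \<longrightarrow> (\<exists>x. poly p x = 0)"
  then show "\<forall>p :: 'a poly. odd (degree p) \<and> degree p > 1 \<longrightarrow> \<not> irreducible p"
    using irreducible_odd_degree_imp_rootless_prime_degree by blast
qed

end
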